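(* Superclub at $\omega_1$ (i.e. $\clubsuit^{\Diamond}_{\omega_1}$) implies $\mathfrak{s}=\omega_1$.
   Context: $\clubsuit^{\Diamond}_{\omega_1}$ is the existence of a sequence $(S_\alpha\mid\alpha<\omega_1)$ with $S_\alpha\subseteq\alpha$ such that for every $A\in[\omega_1]^{\omega_1}$ there is $B\in[A]^{\omega_1}$ for which $\{\alpha<\omega_1\mid B\cap\alpha=S_\alpha\}$ is stationary in $\omega_1$. For an infinite cardinal $\kappa$ and $B,S\in[\kappa]^\kappa$, $S$ splits $B$ iff $|B\cap S|=|B\setminus S|=\kappa$; a family $\mathcal{F}\subseteq[\kappa]^\kappa$ is splitting iff every $B\in[\kappa]^\kappa$ is split by some member of $\mathcal{F}$; $\mathfrak{s}_\kappa$ is the minimal cardinality of a splitting family, and $\mathfrak{s}=\mathfrak{s}_{\aleph_0}$. *)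

theory Defs
  imports Main "HOL-Library.Countable_Set"
begin

text \<open>omega1 r: the well-order r on the whole type 'a has order type omega_1,
 i.e. it is uncountable and every proper initial segment is countable.
 The elements of 'a play the role of the countable ordinals alpha < omega_1;
 the ordinal alpha, viewed as a set, is underS r alpha.\<close>
definition omega1 :: "'a rel \<Rightarrow> bool" where
  "omega1 r \<longleftrightarrow> Well_order r \<and> Field r = UNIV \<and> \<not> countable (UNIV :: 'a set)
     \<and> (\<forall>\<alpha>. countable (underS r \<alpha>))"

definition club :: "'a rel \<Rightarrow> 'a set \<Rightarrow> bool" where
  "club r C \<longleftrightarrow>
     (\<forall>\<alpha>. \<exists>\<beta>\<in>C. \<alpha> \<in> underS r \<beta>) \<and>
     (\<forall>\<alpha>. (\<exists>\<beta>. \<beta> \<in> underS r \<alpha>) \<and>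
           (\<forall>\<beta>\<in>underS r \<alpha>. \<exists>\<gamma>\<in>C. \<beta> \<in> underS r \<gamma> \<and> \<gamma> \<in> underS r \<alpha>)
           \<longrightarrow> \<alpha> \<in> C)"

definition stationary :: "'a rel \<Rightarrow> 'a set \<Rightarrow> bool" where
  "stationary r X \<longleftrightarrow> (\<forall>C. club r C \<longrightarrow> X \<inter> C \<noteq> {})"

text \<open>Superclub at omega_1.  [omega_1]^omega_1 = uncountable subsets.\<close>
definition superclub :: "'a rel \<Rightarrow> bool" where
  "superclub r \<longleftrightarrow> (\<exists>S :: 'a \<Rightarrow> 'a set.
     (\<forall>\<alpha>. S \<alpha> \<subseteq> underS r \<alpha>) \<and>
     (\<forall>A. \<not> countable A \<longrightarrow>
        (\<exists>B\<subseteq>A. \<not> countable B \<and> stationary r {\<alpha>. B \<inter> underS r \<alpha> = S \<alpha>})))"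

definition splits :: "nat set \<Rightarrow> nat set \<Rightarrow> bool" where
  "splits S B \<longleftrightarrow> infinite (B \<inter> S) \<and> infinite (B - S)"

definition splitting_family :: "nat set set \<Rightarrow> bool" where
  "splitting_family F \<longleftrightarrow> (\<forall>S\<in>F. infinite S) \<and>
     (\<forall>B. infinite B \<longrightarrow> (\<exists>S\<in>F. splits S B))"

end

theory Submission
  imports Defs "HOL-Library.Diagonal_Subsequence"
begin

text \<open>
  Given a superclub sequence \<open>S\<close>, choose sets \<open>X \<xi>\<close> of naturals by recursion on \<open>\<xi>\<close> so that \<open>X \<xi>\<close>
  splits every infinite set among \<open>\<Inter>\<eta>\<in>S \<beta>. X \<eta>\<close> and \<open>\<Inter>\<eta>\<in>S \<beta>. - X \<eta>\<close> with \<open>\<beta> \<le> \<xi>\<close>. If no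
  \<open>X \<xi>\<close> split the infinite set \<open>B\<close>, then for uncountably many \<open>\<xi>\<close> one fixed tail of \<open>B\<close> would lie
  in \<open>X \<xi>\<close> (or, symmetrically, in \<open>- X \<xi>\<close>). Pass to an uncountable set \<open>A\<close> of such indices guessed
  by \<open>S\<close>. The intersections of the \<open>X \<eta>\<close> over \<open>A \<inter> \<alpha>\<close> decrease with \<open>\<alpha>\<close> and are sets of naturals,
  so they stabilise at a countable stage. If \<open>A \<inter> \<alpha> = S \<alpha>\<close> beyond that stage and \<open>\<alpha> \<le> \<xi> \<in> A\<close>, then
  \<open>X \<xi>\<close> splits an infinite intersection that is contained in \<open>X \<xi>\<close>, which is absurd.
\<close>

section \<open>Countable families of sets of naturals, and the lower bound\<close>

lemma countable_family_has_common_splitter: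
  assumes "countable \<E>" and inf: "\<And>E. E \<in> \<E> \<Longrightarrow> infinite E"
  shows "\<exists>X. \<forall>E\<in>\<E>. splits X E"
proof (cases "\<E> = {}")
  case False
  define e where "e n = from_nat_into \<E> n" for n
  have e: "range e = \<E>"
    unfolding e_def using False assms(1) by (simp add: range_from_nat_into)
  \<comment> \<open>\<open>prod_decode\<close> visits every \<open>e n\<close> infinitely often, and
    strict growth of \<open>f\<close> makes all chosen elements distinct.\<close>
  have "\<exists>f. \<forall>k. f k \<in> e (fst (prod_decode k)) \<and> f k < f (Suc k)"
  proof (rule dependent_nat_choice)
    have "infinite (e n)" for n using inf e by blast
    then show "\<exists>x. x \<in> e (fst (prod_decode 0))"
      using infinite_imp_nonempty by blast
    show "\<exists>y. y \<in> e (fst (prod_decode (Suc k))) \<and> x < y" for x k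
      using \<open>\<And>n. infinite (e n)\<close> by (meson infinite_nat_iff_unbounded)
  qed
  then obtain f where f: "\<And>k. f k \<in> e (fst (prod_decode k))" and "\<And>k. f k < f (Suc k)"
    by blast
  then have "inj f"
    by (simp add: strict_mono_Suc_iff strict_mono_imp_inj_on)
  define g where "g n m = f (prod_encode (n, m))" for n m
  have g: "g n m \<in> e n" for n m
    using f[of "prod_encode (n, m)"] by (simp add: g_def)
  have g_inj: "g n m = g n' m' \<longleftrightarrow> n = n' \<and> m = m'" for n m n' m'
    using \<open>inj f\<close> by (simp add: g_def inj_eq)
  \<comment> \<open>Of the elements picked from each \<open>e n\<close>, those with even second
    index enter \<open>X\<close>; by injectivity of \<open>g\<close>, those with odd index stay
    out.\<close>
  define X where "X = {g n (2 * m) | n m. True}"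
  have "splits X (e n)" for n
    unfolding splits_def
  proof
    have "inj (\<lambda>m. g n (2 * m))" by (simp add: inj_on_def g_inj)
    moreover have "range (\<lambda>m. g n (2 * m)) \<subseteq> e n \<inter> X" using g by (auto simp: X_def)
    ultimately show "infinite (e n \<inter> X)" using infinite_super range_inj_infinite by blast
    have "inj (\<lambda>m. g n (2 * m + 1))" by (simp add: inj_on_def g_inj)
    moreover have "range (\<lambda>m. g n (2 * m + 1)) \<subseteq> e n - X"
      using g by (auto simp: X_def g_inj) presburger
    ultimately show "infinite (e n - X)" using infinite_super range_inj_infinite by blast
  qed
  then show ?thesis using e by blast
qed simp

text \<open>Against an enumeration \<open>e\<close> of \<open>F\<close>, a diagonal subsequence of
  the naturals lies, up to finitely many terms, inside or outside each \<open>e n\<close>, so no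
  \<open>e n\<close> splits its range.\<close>

lemma splitting_family_uncountable:
  assumes "splitting_family F"
  shows "\<not> countable F"
proof
  assume "countable F"
  have "F \<noteq> {}"
    using assms infinite_UNIV_nat unfolding splitting_family_def by blast
  define e where "e = from_nat_into F"
  have e: "range e = F"
    unfolding e_def using \<open>F \<noteq> {}\<close> \<open>countable F\<close> by (rule range_from_nat_into)
  define P where "P n s \<longleftrightarrow> (\<forall>k. s k \<in> e n) \<or> (\<forall>k. s k \<notin> e n)" for n and s :: "nat \<Rightarrow> nat"
  interpret subseqs P
  proof
    fix n and s :: "nat \<Rightarrow> nat"
    obtain b where b: "infinite {k. (s k \<in> e n) = b}"
    proof -
      have "{k. (s k \<in> e n) = True} \<union> {k. (s k \<in> e n) = False} = UNIV" by auto
      then have "infinite ({k. (s k \<in> e n) = True} \<union> {k. (s k \<in> e n) = False})"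
        by (simp only: infinite_UNIV_nat not_False_eq_True)
      then show ?thesis
        using that[of True] that[of False] unfolding finite_Un by blast
    qed
    obtain t :: "nat \<Rightarrow> nat" where "strict_mono t" "\<forall>k. t k \<in> {k. (s k \<in> e n) = b}"
      using infinite_enumerate[OF b] by blast
    then show "\<exists>t. strict_mono t \<and> P n (s \<circ> t)"
      by (cases b) (auto simp: P_def intro!: exI[of _ t])
  qed
  \<comment> \<open>The property passes to subsequences, but the diagonal sequence is sure to have
    it only once the terms with index up to \<open>n\<close> are dropped.\<close>
  have P: "P n (diagseq \<circ> (+) (Suc n))" for n
    by (rule diagseq_holds) (auto simp: P_def)
  define B where "B = range diagseq"
  have "inj diagseq"
    using subseq_diagseq by (rule strict_mono_imp_inj_on)
  then have "infinite B"
    unfolding B_def by (rule range_inj_infinite)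
  then obtain n where n: "splits (e n) B"
    using assms e unfolding splitting_family_def by blast
  have "B \<subseteq> diagseq ` {..n} \<union> range (diagseq \<circ> (+) (Suc n))"
  proof
    fix x assume "x \<in> B"
    then obtain k where "x = diagseq k" by (auto simp: B_def)
    then show "x \<in> diagseq ` {..n} \<union> range (diagseq \<circ> (+) (Suc n))"
      by (cases "k \<le> n") (auto simp: image_iff dest!: not_le_imp_less less_imp_Suc_add)
  qed
  then have "B \<inter> e n \<subseteq> diagseq ` {..n} \<or> B - e n \<subseteq> diagseq ` {..n}"
    using P[of n] unfolding P_def by fastforce
  then show False
    using n unfolding splits_def by (meson finite_atMost finite_imageI finite_subset)
qed

text \<open>A family of smaller cardinality would be equipotent to a proper initial segment of
  \<open>r\<close>, hence countable.\<close>

lemma omega1_card_le: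
  assumes "omega1 (r :: 'a rel)" and "\<not> countable F"
  shows "ordLeq2 (card_of (UNIV :: 'a set)) (card_of F)"
proof (rule ccontr)
  assume "\<not> ?thesis"
  then have "ordLess2 (card_of F) (card_of (UNIV :: 'a set))"
    by (metis not_ordLeq_iff_ordLess card_of_Well_order)
  moreover have r: "Well_order r" "Field r = UNIV" "countable (underS r a)" for a
    using assms(1) by (auto simp: omega1_def)
  then have "ordLeq2 (card_of (UNIV :: 'a set)) r"
    by (metis card_of_least)
  ultimately have "ordLess2 (card_of F) r"
    by (rule ordLess_ordLeq_trans)
  then obtain a where "ordIso2 (card_of F) (Restr r (underS r a))"
    using ordLess_iff_ordIso_Restr[OF r(1) card_of_Well_order] by blast
  then have "ordIso2 (card_of (Field (card_of F))) (card_of (Field (Restr r (underS r a))))"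
    by (rule card_of_cong)
  then obtain h where "bij_betw h F (Field (Restr r (underS r a)))"
    by (auto simp: card_of_ordIso[symmetric] Field_card_of)
  moreover have "countable (Field (Restr r (underS r a)))"
    by (rule countable_subset[OF Field_Restr_subset r(3)])
  ultimately show False
    using assms(2) countable_image_inj_on[of h F] by (auto simp: bij_betw_def)
qed

section \<open>Countable ordinals: bounds, club sets, recursion\<close>

context
  fixes r :: "'a rel"
  assumes omega1: "omega1 r"
begin

lemma omega1_strict_wf: "wf (r - Id)"
  and omega1_antisym: "antisym r"
  and omega1_trans: "trans r"
  using omega1 unfolding omega1_def well_order_on_def linear_order_on_def partial_order_on_def
    preorder_on_def by blast+

lemma omega1_total: "(x, y) \<in> r \<or> (y, x) \<in> r"
  using omega1 unfolding omega1_def well_order_on_def linear_order_on_def partial_order_on_def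
    preorder_on_def total_on_def refl_on_def by (metis UNIV_I)

lemma omega1_countable_underS: "countable (underS r x)"
  using omega1 by (simp add: omega1_def)

lemma omega1_countable_under: "countable (under r x)"
  by (rule countable_subset[of _ "insert x (underS r x)"])
    (auto simp: under_def underS_def omega1_countable_underS[unfolded underS_def])

lemma omega1_underS_or_above: "y \<in> underS r x \<or> (x, y) \<in> r"
  using omega1_total[of x y] by (auto simp: underS_def)

lemma omega1_underS_under_trans:
  assumes "x \<in> underS r y" "(y, z) \<in> r"
  shows "x \<in> underS r z"
proof -
  have "(x, y) \<in> r" "x \<noteq> y" using assms(1) by (auto simp: underS_def)
  then have "(x, z) \<in> r" "x \<noteq> z"
    using assms(2) transD[OF omega1_trans] antisymD[OF omega1_antisym] by blast+
  then show ?thesis by (simp add: underS_def)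
qed

lemma omega1_underS_trans: "x \<in> underS r y \<Longrightarrow> y \<in> underS r z \<Longrightarrow> x \<in> underS r z"
  by (rule omega1_underS_under_trans) (auto simp: underS_def)

text \<open>Regularity of omega_1: countably many countable segments cannot exhaust an uncountable
  type, and any point outside all of them is a bound.\<close>

lemma omega1_countable_bounded:
  assumes "countable N"
  obtains b where "N \<subseteq> underS r b"
proof -
  have "countable (\<Union>x\<in>N. under r x)"
    using assms omega1_countable_under by blast
  then obtain b where "b \<notin> (\<Union>x\<in>N. under r x)"
    using omega1 by (metis UNIV_eq_I omega1_def)
  then have "N \<subseteq> underS r b"
    using omega1_underS_or_above[of _ b] by (auto simp: under_def)
  then show thesis by (rule that)
qed

text \<open>Every final segment is club, so a stationary set meets it.\<close>

lemma stationary_unbounded: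
  assumes "stationary r T"
  obtains a where "a \<in> T" "b \<in> underS r a"
proof -
  have "club r {a. b \<in> underS r a}"
    unfolding club_def
  proof (intro conjI allI impI)
    fix x
    obtain c where "{x, b} \<subseteq> underS r c"
      by (rule omega1_countable_bounded[of "{x, b}"]) auto
    then show "\<exists>c\<in>{a. b \<in> underS r a}. x \<in> underS r c" by blast
  qed (use omega1_underS_trans in blast)
  then show thesis
    using assms that unfolding stationary_def by blast
qed

text \<open>Each natural outside the full intersection is expelled at some index; there are only
  countably many naturals, so the chosen indices are bounded.\<close>

lemma INTER_stabilises:
  fixes Y :: "'a \<Rightarrow> nat set"
  obtains b where "\<And>a. b \<in> underS r a \<Longrightarrow> (\<Inter>x\<in>A \<inter> underS r a. Y x) = (\<Inter>x\<in>A. Y x)"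
proof -
  define h where "h n = (SOME x. x \<in> A \<and> n \<notin> Y x)" for n
  have h: "h n \<in> A \<and> n \<notin> Y (h n)" if "n \<notin> (\<Inter>x\<in>A. Y x)" for n
    unfolding h_def by (rule someI_ex) (use that in blast)
  obtain b where b: "range h \<subseteq> underS r b"
    by (rule omega1_countable_bounded[of "range h"]) auto
  show thesis
  proof (rule that)
    fix a assume "b \<in> underS r a"
    then have "range h \<subseteq> underS r a"
      using b omega1_underS_trans by blast
    then show "(\<Inter>x\<in>A \<inter> underS r a. Y x) = (\<Inter>x\<in>A. Y x)"
      using h by blast
  qed
qed

text \<open>Only countably many pairs \<open>(b, i)\<close> matter at stage \<open>x\<close>, so one
  set meets all requirements. The boolean \<open>i\<close> handles intersections of the
  \<open>X y\<close> and of their complements at once.\<close>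

lemma recursive_splitters:
  assumes S: "\<And>a. S a \<subseteq> underS r a"
  obtains X :: "'a \<Rightarrow> nat set"
    where "\<And>b x i. (b, x) \<in> r \<Longrightarrow> infinite (\<Inter>y\<in>S b. {n. (n \<in> X y) = i})
      \<Longrightarrow> splits (X x) (\<Inter>y\<in>S b. {n. (n \<in> X y) = i})"
proof -
  define E where "E X b i = (\<Inter>y\<in>S b. {n. (n \<in> X y) = i})" for X :: "'a \<Rightarrow> nat set" and b i
  define P where "P X x Z \<longleftrightarrow> (\<forall>b i. (b, x) \<in> r \<longrightarrow> infinite (E X b i) \<longrightarrow> splits Z (E X b i))"
    for X x Z
  have "\<exists>X. \<forall>x. P X x (X x)"
  proof (rule dependent_wf_choice[OF omega1_strict_wf])
    fix X Y :: "'a \<Rightarrow> nat set" and x Z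
    assume eq: "\<And>z. (z, x) \<in> r - Id \<Longrightarrow> X z = Y z"
    \<comment> \<open>The recursion needs \<open>P X x\<close> to read \<open>X\<close> only below
      \<open>x\<close>: if \<open>y\<close> lies in \<open>S b\<close> and \<open>b\<close> is at
      most \<open>x\<close>, then \<open>y\<close> is strictly below \<open>x\<close>.\<close>
    have "E X b i = E Y b i" if "(b, x) \<in> r" for b i
    proof -
      have "X y = Y y" if "y \<in> S b" for y
      proof (rule eq)
        have "y \<in> underS r b" using S that by blast
        then have "y \<in> underS r x"
          using \<open>(b, x) \<in> r\<close> by (rule omega1_underS_under_trans)
        then show "(y, x) \<in> r - Id" by (auto simp: underS_def)
      qed
      then show ?thesis by (simp add: E_def)
    qed
    then show "P X x Z = P Y x Z" by (auto simp: P_def)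
  next
    fix X :: "'a \<Rightarrow> nat set" and x
    define \<E> where "\<E> = {D \<in> (\<lambda>(b, i). E X b i) ` (under r x \<times> UNIV). infinite D}"
    have "countable \<E>"
      unfolding \<E>_def by (intro countable_Collect countable_image countable_SIGMA
          omega1_countable_under countableI_type)
    moreover have "infinite D" if "D \<in> \<E>" for D
      using that by (simp add: \<E>_def)
    ultimately obtain Z where Z: "\<forall>D\<in>\<E>. splits Z D"
      using countable_family_has_common_splitter by blast
    have "P X x Z"
      unfolding P_def
    proof (intro allI impI)
      fix b i assume "(b, x) \<in> r" "infinite (E X b i)"
      then have "E X b i \<in> \<E>"
        unfolding \<E>_def by (auto simp: under_def intro!: image_eqI[of _ _ "(b, i)"])
      then show "splits Z (E X b i)" using Z by blast
    qed
    then show "\<exists>Z. P X x Z" ..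
  qed
  then show thesis
    using that unfolding P_def E_def by blast
qed

section \<open>From superclub to a splitting family\<close>

lemma superclub_splitting_family:
  assumes "superclub r"
  obtains X :: "'a \<Rightarrow> nat set" where "splitting_family (range X)"
proof -
  obtain S where S: "\<And>a. S a \<subseteq> underS r a"
    and guess: "\<And>A. \<not> countable A \<Longrightarrow>
      \<exists>B\<subseteq>A. \<not> countable B \<and> stationary r {a. B \<inter> underS r a = S a}"
    using assms unfolding superclub_def by blast
  obtain X :: "'a \<Rightarrow> nat set"
    where X: "\<And>b x i. (b, x) \<in> r \<Longrightarrow> infinite (\<Inter>y\<in>S b. {n. (n \<in> X y) = i})
      \<Longrightarrow> splits (X x) (\<Inter>y\<in>S b. {n. (n \<in> X y) = i})"
    using recursive_splitters[OF S] by blast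
  have split: "\<exists>x. splits (X x) B" if "infinite B" for B
  proof (rule ccontr)
    assume "\<nexists>x. splits (X x) B"
    \<comment> \<open>As \<open>X x\<close> does not split \<open>B\<close>, membership in
      \<open>X x\<close> is constant on a tail of \<open>B\<close>; \<open>p\<close> records where
      the tail starts and the truth value.\<close>
    have "\<exists>p. \<forall>k\<in>B. fst p \<le> k \<longrightarrow> (k \<in> X x) = snd p" for x
    proof -
      obtain i where "finite {k\<in>B. (k \<in> X x) \<noteq> i}"
      proof -
        have "B \<inter> X x = {k\<in>B. (k \<in> X x) \<noteq> False}" "B - X x = {k\<in>B. (k \<in> X x) \<noteq> True}"
          by auto
        then show thesis
          using \<open>\<nexists>x. splits (X x) B\<close> that[of False] that[of True] unfolding splits_def by (metis (full_types))
      qed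
      then obtain n where "\<forall>k\<in>{k\<in>B. (k \<in> X x) \<noteq> i}. k < n"
        unfolding finite_nat_set_iff_bounded by blast
      then show ?thesis
        by (intro exI[of _ "(n, i)"]) (auto simp: not_less[symmetric])
    qed
    then obtain t where t: "\<And>x. \<forall>k\<in>B. fst (t x) \<le> k \<longrightarrow> (k \<in> X x) = snd (t x)"
      by metis
    \<comment> \<open>There are only countably many pairs \<open>p\<close>, so some fibre of
      \<open>t\<close> is uncountable.\<close>
    have "UNIV = (\<Union>p. t -` {p})" by auto
    then obtain p where "\<not> countable (t -` {p})"
      using omega1 unfolding omega1_def by (metis countableI_type countable_UN)
    then obtain A where A: "A \<subseteq> t -` {p}" "\<not> countable A"
      and stat: "stationary r {a. A \<inter> underS r a = S a}"
      using guess by blast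
    obtain n i where "p = (n, i)" by (cases p)
    define Y where "Y x = {k. (k \<in> X x) = i}" for x
    have Y: "{k\<in>B. n \<le> k} \<subseteq> Y x" if "x \<in> A" for x
      using t[of x] A(1) that \<open>p = (n, i)\<close> by (auto simp: Y_def)
    obtain b where b: "\<And>a. b \<in> underS r a \<Longrightarrow> (\<Inter>x\<in>A \<inter> underS r a. Y x) = (\<Inter>x\<in>A. Y x)"
      using INTER_stabilises by blast
    obtain a where a: "A \<inter> underS r a = S a" "b \<in> underS r a"
      using stationary_unbounded[OF stat] by blast
    have Sa: "(\<Inter>x\<in>S a. Y x) = (\<Inter>x\<in>A. Y x)"
      using a b by metis
    \<comment> \<open>The uncountable \<open>A\<close> is not contained in the countable
      \<open>underS r a\<close>, and an element \<open>x\<close> at or above \<open>a\<close> comes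
      late enough for \<open>X x\<close> to take \<open>S a\<close> into account.\<close>
    obtain x where x: "x \<in> A" "(a, x) \<in> r"
      using A(2) omega1_countable_underS omega1_underS_or_above
      by (metis countable_subset subsetI)
    have "infinite {k\<in>B. n \<le> k}"
      using \<open>infinite B\<close> unfolding infinite_nat_iff_unbounded_le
      by (metis (mono_tags, lifting) max.bounded_iff mem_Collect_eq)
    then have "infinite (\<Inter>x\<in>S a. Y x)"
      unfolding Sa using Y by (meson INT_greatest infinite_super)
    then have "splits (X x) (\<Inter>x\<in>A. Y x)"
      using X[OF x(2)] Sa unfolding Y_def by metis
    moreover have "(\<Inter>x\<in>A. Y x) \<subseteq> Y x" using x(1) by blast
    then have "(\<Inter>x\<in>A. Y x) \<inter> X x = {} \<or> (\<Inter>x\<in>A. Y x) - X x = {}"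
      unfolding Y_def by (cases i) auto
    ultimately show False
      unfolding splits_def by (metis finite.emptyI)
  qed
  have "infinite (X x)" for x
  proof -
    \<comment> \<open>At the least element \<open>z\<close> the set \<open>S z\<close> is empty, so
      the intersection is the set of all naturals; splitting it makes \<open>X x\<close>
      infinite.\<close>
    obtain z where "\<And>y. (y, z) \<notin> r - Id"
      using omega1_strict_wf by (metis UNIV_I wfE_min)
    then have "S z = {}" "(z, x) \<in> r"
      using S[of z] omega1_underS_or_above[of x z] by (auto simp: underS_def)
    then show ?thesis
      using X[of z x True] by (simp add: splits_def)
  qed
  then have "splitting_family (range X)"
    using split by (auto simp: splitting_family_def)
  then show thesis by (rule that)
qed

end

theorem theorem3p2:
  fixes r :: "'a rel"
  assumes "omega1 r" and "superclub r"
  shows "(\<exists>F. splitting_family F \<and> ordIso2 (card_of F) (card_of (UNIV :: 'a set))) \<and>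
         (\<forall>F. splitting_family F \<longrightarrow> ordLeq2 (card_of (UNIV :: 'a set)) (card_of F))"
proof -
  have lower: "ordLeq2 (card_of (UNIV :: 'a set)) (card_of F)" if "splitting_family F" for F
    using omega1_card_le[OF assms(1) splitting_family_uncountable[OF that]] .
  obtain X :: "'a \<Rightarrow> nat set" where X: "splitting_family (range X)"
    using superclub_splitting_family[OF assms] .
  \<comment> \<open>\<open>X\<close> may repeat values: its range has at most the size of
    \<open>'a\<close>, and the lower bound gives equality.\<close>
  moreover have "ordIso2 (card_of (range X)) (card_of (UNIV :: 'a set))"
    using card_of_image lower[OF X] by (simp add: ordIso_iff_ordLeq)
  ultimately show ?thesis
    using lower by blast
qed

end
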